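(* Let $n\ge2$ and $\omega=e^{2\pi i/n}$, $F_n=\frac1{\sqrt n}(\omega^{jk})_{0\le j,k\le n-1}$. (1) If $n$ is a prime power, then for every tuple of nonnegative integers $(s_0,\dots,s_{n-1})$ with $\sum_is_i=n$ we have $\langle s_0,\dots,s_{n-1}|\hat F_n|1,\dots,1\rangle\neq0$ if and only if $\sum_i i\,s_i\equiv0\pmod n$ (the Zero Transmission Law). In particular, the ideal patterns of $F_n$ are exactly the tuples with $\sum_is_i=n$, $s_0=1$ and $\sum_i i\,s_i\equiv0\pmod n$. (2) If $n>1$ is not a prime power, there exists a tuple $(s_0,\dots,s_{n-1})$ with $\sum_is_i=n$, $s_0=1$ and $\sum_i i\,s_i\equiv0\pmod n$ which is not an ideal pattern, i.e. $\langle s_0,\dots,s_{n-1}|\hat F_n|1,\dots,1\rangle=0$.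
   Context: $\hat U$ denotes the linear optical unitary on $n$ bosons in $n$ modes induced by the $n\times n$ unitary $U$ via $a_j^\dagger\mapsto\sum_iU_{ij}a_i^\dagger$; $|s_0,\dots,s_{n-1}\rangle$ is the Fock state with $s_i$ photons in mode $i$, and $|1,\dots,1\rangle$ has one photon in each mode. An ideal pattern of $U$ is a tuple $(s_0,\dots,s_{n-1})$ with $\sum s_i=n$, $s_0=1$ and $\langle s_0,\dots,s_{n-1}|\hat U|1,\dots,1\rangle\ne0$. *)

theory Defs
  imports "HOL-Analysis.Analysis" "HOL-Number_Theory.Number_Theory"
begin

text \<open>Matrices are n x n complex matrices given as functions on indices 0..n-1.
A Fock configuration (s_0,...,s_{n-1}) is a list s of length n.

The linear optical unitary maps a_j^dag to sum_i U i j a_i^dag, so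
  hat U |1,...,1> = prod_j (sum_i U i j a_i^dag) |0>.
Expanding the product, a term is a choice function f : {0..n-1} -> {0..n-1}
(mode f j for photon j), contributing prod_j U (f j) j times the monomial
prod_i (a_i^dag)^(s_i), where s_i = number of j with f j = i.  Since
(a_i^dag)^s |0> = sqrt(s!) |s>, the amplitude <s|hat U|1,...,1> equals
sqrt(prod_i s_i!) times the sum of prod_j U (f j) j over all f with fibre
sizes s.\<close>

definition fock_amp :: "nat \<Rightarrow> (nat \<Rightarrow> nat \<Rightarrow> complex) \<Rightarrow> nat list \<Rightarrow> complex" where
  "fock_amp n U s =
     complex_of_real (sqrt (real (\<Prod>i<n. fact (s ! i))))
     * (\<Sum>f \<in> {f. f \<in> {..<n} \<rightarrow>\<^sub>E {..<n} \<and> (\<forall>i<n. card {j\<in>{..<n}. f j = i} = s ! i)}.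
          \<Prod>j<n. U (f j) j)"

definition fourier :: "nat \<Rightarrow> nat \<Rightarrow> nat \<Rightarrow> complex" where
  "fourier n j k = cis (2 * pi * real (j * k) / real n) / complex_of_real (sqrt (real n))"

definition ideal_pattern :: "nat \<Rightarrow> (nat \<Rightarrow> nat \<Rightarrow> complex) \<Rightarrow> nat list \<Rightarrow> bool" where
  "ideal_pattern n U s \<longleftrightarrow> length s = n \<and> sum_list s = n \<and> s ! 0 = 1 \<and> fock_amp n U s \<noteq> 0"

end

theory Submission
  imports Defs "HOL-Combinatorics.Combinatorics"
begin

text \<open>Up to a nonzero factor, the amplitude is a sum over injections, weighted by roots of unity, and
  expands over blocks of exponents with sum \<open>0\<close> modulo \<open>n\<close>; a block of size \<open>b\<close> has weight
  \<open>\<plusminus>n (b - 1)!\<close>. If \<open>n\<close> is a power of \<open>p\<close>, the single block containing everything contributes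
  \<open>\<plusminus>n!\<close>, whose \<open>p\<close>-adic valuation is strictly smaller than that of all other contributions. If \<open>n\<close> is not
  a prime power, there is a nontrivial idempotent \<open>t\<close> modulo \<open>n\<close>, and one can choose \<open>t + 1\<close> nonzero
  exponents having just \<open>m = t (t - 1) / n\<close> proper zero-sum partitions, each into a pair and its complement, so that the
  expansion is proportional to \<open>t (t - 1) - n m = 0\<close>.\<close>

section \<open>Sums over injections\<close>

text \<open>For \<open>I\<close> and \<open>X\<close> of equal size this is the permanent of the
  matrix \<open>g\<close>. Rectangular shapes occur because the block expansion deletes rows while
  keeping every column.\<close>

definition inj_sum :: "'b set \<Rightarrow> ('a \<Rightarrow> 'b \<Rightarrow> 'c::comm_ring_1) \<Rightarrow> 'a set \<Rightarrow> 'c" where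
  "inj_sum X g I = (\<Sum>f \<in> {f \<in> I \<rightarrow>\<^sub>E X. inj_on f I}. \<Prod>i\<in>I. g i (f i))"

lemma inj_sum_empty [simp]: "inj_sum X g {} = 1"
  by (simp add: inj_sum_def)

lemma finite_inj_PiE: "finite X \<Longrightarrow> finite I \<Longrightarrow> finite {f \<in> I \<rightarrow>\<^sub>E X. inj_on f I}"
  by (simp add: finite_PiE)

lemma inj_sum_cong:
  assumes "\<And>i x. i \<in> I \<Longrightarrow> x \<in> X \<Longrightarrow> g i x = h i x"
  shows "inj_sum X g I = inj_sum X h I"
  unfolding inj_sum_def using assms by (intro sum.cong prod.cong refl) auto

text \<open>Laplace expansion of a permanent along row \<open>i\<close>: using column
  \<open>x\<close> there bars it for all other rows.\<close>

lemma inj_sum_insert: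
  assumes X: "finite X" and I: "finite I" "i \<notin> I"
  shows "inj_sum X g (insert i I) = (\<Sum>x\<in>X. g i x * inj_sum (X - {x}) g I)"
proof -
  have "(\<Sum>x\<in>X. g i x * inj_sum (X - {x}) g I) =
      (\<Sum>(x, f) \<in> (SIGMA x:X. {f \<in> I \<rightarrow>\<^sub>E X - {x}. inj_on f I}). g i x * (\<Prod>j\<in>I. g j (f j)))"
    unfolding inj_sum_def sum_distrib_left
    using X I by (subst sum.Sigma) (auto intro!: finite_inj_PiE)
  also have "\<dots> = inj_sum X g (insert i I)"
    unfolding inj_sum_def
  proof (rule sum.reindex_bij_witness[where i = "\<lambda>f. (f i, restrict f I)" and j = "\<lambda>(x, f). f(i := x)"])
    fix a assume a: "a \<in> (SIGMA x:X. {f \<in> I \<rightarrow>\<^sub>E X - {x}. inj_on f I})"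
    then obtain x f where xf: "a = (x, f)" "x \<in> X" "f \<in> I \<rightarrow>\<^sub>E X - {x}" "inj_on f I" by auto
    have "restrict (f(i := x)) I = f"
      using xf I by (auto simp: restrict_def PiE_def extensional_def fun_eq_iff)
    then show "(\<lambda>f. (f i, restrict f I)) ((\<lambda>(x, f). f(i := x)) a) = a"
      using xf by simp
    have "f(i := x) \<in> insert i I \<rightarrow>\<^sub>E X"
      using xf by (auto simp: PiE_def Pi_def extensional_def)
    moreover have "inj_on (f(i := x)) (insert i I)"
      using xf I by (auto simp: inj_on_def PiE_def Pi_def)
    ultimately show "(\<lambda>(x, f). f(i := x)) a \<in> {f \<in> insert i I \<rightarrow>\<^sub>E X. inj_on f (insert i I)}"
      using xf by simp
    have "(\<Prod>j\<in>I. g j ((f(i := x)) j)) = (\<Prod>j\<in>I. g j (f j))"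
      using I by (intro prod.cong) auto
    then show "(\<Prod>j\<in>insert i I. g j ((\<lambda>(x, f). f(i := x)) a j)) =
        (\<lambda>(x, f). g i x * (\<Prod>j\<in>I. g j (f j))) a"
      using xf I by simp
  next
    fix f assume f: "f \<in> {f \<in> insert i I \<rightarrow>\<^sub>E X. inj_on f (insert i I)}"
    then show "(\<lambda>(x, f). f(i := x)) ((\<lambda>f. (f i, restrict f I)) f) = f"
      using I by (auto simp: restrict_def PiE_def extensional_def fun_eq_iff)
    show "(\<lambda>f. (f i, restrict f I)) f \<in> (SIGMA x:X. {f \<in> I \<rightarrow>\<^sub>E X - {x}. inj_on f I})"
      using f I by (auto simp: inj_on_def PiE_def Pi_def)
  qed
  finally show ?thesis by simp
qed

text \<open>An injection either misses \<open>x\<close> or attains it exactly once.\<close>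
lemma inj_sum_split_value:
  assumes "finite X" "finite J" "x \<in> X"
  shows "inj_sum X g J =
    inj_sum (X - {x}) g J + (\<Sum>j\<in>J. g j x * inj_sum (X - {x}) g (J - {j}))"
  using assms(2,1,3)
proof (induction J arbitrary: X rule: finite_induct)
  case (insert j J)
  have fX: "finite (X - {x})" using insert.prems by simp
  have sw: "X - {y} - {x} = X - {x} - {y}" for y by auto
  \<comment> \<open>The new position \<open>j\<close> takes either the value \<open>x\<close> or
    some other \<open>y\<close>; in the second case the induction hypothesis, general in the value
    set, is applied with \<open>y\<close> removed.\<close>
  have "inj_sum X g (insert j J) =
      g j x * inj_sum (X - {x}) g J + (\<Sum>y\<in>X - {x}. g j y * inj_sum (X - {y}) g J)"
    using insert by (simp add: inj_sum_insert sum.remove)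
  also have "(\<Sum>y\<in>X - {x}. g j y * inj_sum (X - {y}) g J) =
      (\<Sum>y\<in>X - {x}. g j y * (inj_sum (X - {x} - {y}) g J
         + (\<Sum>i\<in>J. g i x * inj_sum (X - {x} - {y}) g (J - {i}))))"
  proof (intro sum.cong refl arg_cong2[where f = "(*)"])
    fix y assume "y \<in> X - {x}"
    then show "inj_sum (X - {y}) g J = inj_sum (X - {x} - {y}) g J
         + (\<Sum>i\<in>J. g i x * inj_sum (X - {x} - {y}) g (J - {i}))"
      using insert.IH[of "X - {y}"] insert.prems by (auto simp: sw)
  qed
  also have "\<dots> = (\<Sum>y\<in>X - {x}. g j y * inj_sum (X - {x} - {y}) g J)
      + (\<Sum>i\<in>J. g i x * (\<Sum>y\<in>X - {x}. g j y * inj_sum (X - {x} - {y}) g (J - {i})))"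
    by (simp add: ring_distribs sum.distrib sum_distrib_left)
       (subst sum.swap, intro sum.cong refl, simp add: mult_ac)
  also have "(\<Sum>y\<in>X - {x}. g j y * inj_sum (X - {x} - {y}) g J) = inj_sum (X - {x}) g (insert j J)"
    by (rule inj_sum_insert[OF fX insert.hyps, symmetric])
  also have "(\<Sum>i\<in>J. g i x * (\<Sum>y\<in>X - {x}. g j y * inj_sum (X - {x} - {y}) g (J - {i}))) =
      (\<Sum>i\<in>J. g i x * inj_sum (X - {x}) g (insert j J - {i}))"
  proof (intro sum.cong refl arg_cong2[where f = "(*)"])
    fix i assume "i \<in> J"
    then have "insert j J - {i} = insert j (J - {i})" using insert.hyps by auto
    then show "(\<Sum>y\<in>X - {x}. g j y * inj_sum (X - {x} - {y}) g (J - {i})) =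
        inj_sum (X - {x}) g (insert j J - {i})"
      using inj_sum_insert[OF fX, of "J - {i}" j g] insert.hyps by simp
  qed
  finally show ?case
    using insert.hyps by (simp add: algebra_simps)
qed simp

text \<open>Double counting: a set \<open>D\<close> arises as \<open>insert j C\<close> from exactly
  \<open>card D\<close> pairs, one for each \<open>j\<close> in \<open>D\<close>.\<close>

lemma sum_Pow_insert_element:
  fixes h :: "nat \<Rightarrow> 'c::comm_ring_1"
  assumes "finite J"
  shows "(\<Sum>C\<in>Pow J. h (card C) * (\<Sum>j\<in>J - C. M (insert j C))) =
    (\<Sum>D\<in>Pow J. of_nat (card D) * h (card D - 1) * M D)"
proof -
  have "(\<Sum>C\<in>Pow J. h (card C) * (\<Sum>j\<in>J - C. M (insert j C))) =
      (\<Sum>(C, j)\<in>(SIGMA C:Pow J. J - C). h (card C) * M (insert j C))"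
    unfolding sum_distrib_left using assms by (subst sum.Sigma) auto
  also have "\<dots> = (\<Sum>(D, j)\<in>(SIGMA D:Pow J. D). h (card D - 1) * M D)"
    by (rule sum.reindex_bij_witness[where i = "\<lambda>(D, j). (D - {j}, j)" and j = "\<lambda>(C, j). (insert j C, j)"])
       (use assms in \<open>auto simp: insert_absorb finite_subset card_insert_if\<close>)
  also have "\<dots> = (\<Sum>D\<in>Pow J. of_nat (card D) * h (card D - 1) * M D)"
    using assms by (subst sum.Sigma[symmetric]) (auto simp: finite_subset mult_ac)
  finally show ?thesis .
qed

text \<open>Expanding each summand by whether the common value on the block \<open>insert i C\<close> is attained
  outside the block makes the sum telescope.\<close>
theorem inj_sum_block_expansion:
  fixes g :: "'a \<Rightarrow> 'b \<Rightarrow> 'c::comm_ring_1"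
  assumes X: "finite X" and J: "finite J" "i \<notin> J"
  shows "inj_sum X g (insert i J) =
    (\<Sum>C\<in>Pow J. (-1) ^ card C * of_nat (fact (card C)) * (\<Sum>x\<in>X. \<Prod>k\<in>insert i C. g k x) * inj_sum X g (J - C))"
proof -
  \<comment> \<open>In \<open>M C\<close> the value shared by the block \<open>insert i C\<close> is
    barred from all remaining positions, so \<open>M {}\<close> is the row expansion of the
    left-hand side.\<close>
  define M where "M C = (\<Sum>x\<in>X. (\<Prod>k\<in>insert i C. g k x) * inj_sum (X - {x}) g (J - C))" for C
  define h :: "nat \<Rightarrow> 'c" where "h c = (-1) ^ c * of_nat (fact c)" for c
  have M_split: "(\<Sum>x\<in>X. \<Prod>k\<in>insert i C. g k x) * inj_sum X g (J - C) =
      M C + (\<Sum>j\<in>J - C. M (insert j C))" if C: "C \<subseteq> J" for C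
  proof -
    have fC: "finite C" "i \<notin> C" using C J finite_subset by auto
    have "(\<Sum>x\<in>X. \<Prod>k\<in>insert i C. g k x) * inj_sum X g (J - C) =
      (\<Sum>x\<in>X. (\<Prod>k\<in>insert i C. g k x) * (inj_sum (X - {x}) g (J - C)
         + (\<Sum>j\<in>J - C. g j x * inj_sum (X - {x}) g (J - C - {j}))))"
      unfolding sum_distrib_right
      by (intro sum.cong refl arg_cong2[where f = "(*)"] inj_sum_split_value) (use X J in auto)
    also have "\<dots> = M C + (\<Sum>j\<in>J - C. \<Sum>x\<in>X. (\<Prod>k\<in>insert i C. g k x) * (g j x * inj_sum (X - {x}) g (J - C - {j})))"
      by (simp only: ring_distribs sum.distrib sum_distrib_left M_def) (subst sum.swap, rule refl)
    also have "(\<Sum>j\<in>J - C. \<Sum>x\<in>X. (\<Prod>k\<in>insert i C. g k x) * (g j x * inj_sum (X - {x}) g (J - C - {j}))) =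
        (\<Sum>j\<in>J - C. M (insert j C))"
      unfolding M_def
    proof (intro sum.cong refl)
      fix j x assume j: "j \<in> J - C"
      have "j \<notin> insert i C" using j J by auto
      then have "(\<Prod>k\<in>insert i (insert j C). g k x) = g j x * (\<Prod>k\<in>insert i C. g k x)"
        using fC by (subst insert_commute, subst prod.insert) auto
      moreover have "J - insert j C = J - C - {j}" by auto
      ultimately show "(\<Prod>k\<in>insert i C. g k x) * (g j x * inj_sum (X - {x}) g (J - C - {j})) =
          (\<Prod>k\<in>insert i (insert j C). g k x) * inj_sum (X - {x}) g (J - insert j C)"
        by (simp add: mult_ac)
    qed
    finally show ?thesis .
  qed
  have "(\<Sum>C\<in>Pow J. (-1) ^ card C * of_nat (fact (card C)) * (\<Sum>x\<in>X. \<Prod>k\<in>insert i C. g k x) * inj_sum X g (J - C))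
      = (\<Sum>C\<in>Pow J. h (card C) * (M C + (\<Sum>j\<in>J - C. M (insert j C))))"
    by (intro sum.cong refl) (subst M_split[symmetric], auto simp: h_def mult.assoc)
  also have "\<dots> = (\<Sum>C\<in>Pow J. h (card C) * M C) + (\<Sum>C\<in>Pow J. h (card C) * (\<Sum>j\<in>J - C. M (insert j C)))"
    by (simp add: ring_distribs sum.distrib)
  also have "\<dots> = (\<Sum>C\<in>Pow J. (h (card C) + of_nat (card C) * h (card C - 1)) * M C)"
    by (simp add: sum_Pow_insert_element[OF J(1)] ring_distribs sum.distrib)
  \<comment> \<open>For \<open>c > 0\<close> the alternating factorials satisfy
    \<open>h c + c * h (c - 1) = 0\<close>, so only the block of \<open>i\<close> alone
    survives.\<close>
  also have "\<dots> = (\<Sum>C\<in>Pow J. if C = {} then M {} else 0)"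
  proof (intro sum.cong refl)
    fix C assume "C \<in> Pow J"
    then have "finite C" using J finite_subset by auto
    show "(h (card C) + of_nat (card C) * h (card C - 1)) * M C = (if C = {} then M {} else 0)"
    proof (cases "C = {}")
      case False
      then obtain d where d: "card C = Suc d" using \<open>finite C\<close> by (metis card_gt_0_iff gr0_implies_Suc)
      show ?thesis using False by (simp add: d h_def algebra_simps)
    qed (simp add: h_def)
  qed
  also have "\<dots> = M {}" using J by simp
  also have "\<dots> = inj_sum X g (insert i J)"
    using X J by (simp add: M_def inj_sum_insert)
  finally show ?thesis by simp
qed

text \<open>An injection on \<open>I\<close> leaves \<open>card X - card I\<close> values free for
  \<open>i\<close>, and a row of ones does not see which of them is taken.\<close>

lemma inj_sum_insert_one:
  assumes "finite X" "finite I" "i \<notin> I" "\<And>x. x \<in> X \<Longrightarrow> g i x = 1"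
  shows "inj_sum X g (insert i I) = (of_nat (card X) - of_nat (card I)) * inj_sum X g I"
proof -
  have "of_nat (card X) * inj_sum X g I = (\<Sum>x\<in>X. inj_sum X g I)" by simp
  also have "\<dots> = (\<Sum>x\<in>X. inj_sum (X - {x}) g I + (\<Sum>j\<in>I. g j x * inj_sum (X - {x}) g (I - {j})))"
    using assms by (intro sum.cong refl inj_sum_split_value) auto
  also have "\<dots> = (\<Sum>x\<in>X. inj_sum (X - {x}) g I) + (\<Sum>j\<in>I. \<Sum>x\<in>X. g j x * inj_sum (X - {x}) g (I - {j}))"
    by (simp add: sum.distrib) (rule sum.swap)
  also have "(\<Sum>x\<in>X. inj_sum (X - {x}) g I) = inj_sum X g (insert i I)"
    using assms by (simp add: inj_sum_insert)
  also have "(\<Sum>j\<in>I. \<Sum>x\<in>X. g j x * inj_sum (X - {x}) g (I - {j})) = (\<Sum>j\<in>I. inj_sum X g I)"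
  proof (intro sum.cong refl)
    fix j assume "j \<in> I"
    then show "(\<Sum>x\<in>X. g j x * inj_sum (X - {x}) g (I - {j})) = inj_sum X g I"
      using inj_sum_insert[of X "I - {j}" j g] assms by (simp add: insert_absorb)
  qed
  finally show ?thesis by (simp add: algebra_simps)
qed

text \<open>Equal cardinalities make every injection onto, so each column factor \<open>h x\<close>
  is picked up exactly once.\<close>

lemma inj_sum_mult_value:
  assumes "finite X" "finite I" "card I = card X"
  shows "inj_sum X (\<lambda>i x. h x * g i x) I = (\<Prod>x\<in>X. h x) * inj_sum X g I"
  unfolding inj_sum_def sum_distrib_left
proof (intro sum.cong refl)
  fix f assume f: "f \<in> {f \<in> I \<rightarrow>\<^sub>E X. inj_on f I}"
  then have "f ` I = X"
    using assms by (intro card_subset_eq) (auto simp: card_image)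
  then have "(\<Prod>i\<in>I. h (f i)) = (\<Prod>x\<in>X. h x)"
    using f prod.reindex[of f I h] by auto
  then show "(\<Prod>i\<in>I. h (f i) * g i (f i)) = (\<Prod>x\<in>X. h x) * (\<Prod>i\<in>I. g i (f i))"
    by (simp add: prod.distrib)
qed

lemma inj_sum_eq_sum_permutes:
  assumes "finite A"
  shows "inj_sum A g A = (\<Sum>p | p permutes A. \<Prod>i\<in>A. g i (p i))"
  unfolding inj_sum_def
proof (rule sum.reindex_bij_witness[where j = "\<lambda>f i. if i \<in> A then f i else i" and i = "\<lambda>p. restrict p A"])
  fix f assume f: "f \<in> {f \<in> A \<rightarrow>\<^sub>E A. inj_on f A}"
  then show "restrict (\<lambda>i. if i \<in> A then f i else i) A = f"
    by (auto simp: restrict_def PiE_def extensional_def fun_eq_iff)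
  have "f ` A = A" using f assms by (intro endo_inj_surj) auto
  then have "bij_betw f A A" using f by (auto simp: bij_betw_def)
  then have "bij_betw (\<lambda>i. if i \<in> A then f i else i) A A"
    by (subst bij_betw_cong[of A _ f]) auto
  then show "(\<lambda>i. if i \<in> A then f i else i) \<in> {p. p permutes A}"
    by (auto intro: bij_imp_permutes)
qed (auto simp: permutes_not_in fun_eq_iff permutes_in_image permutes_inj_on)

section \<open>Amplitudes and roots of unity\<close>

text \<open>Permutations act transitively on the functions with prescribed fibre sizes, so all the fibres of
  \<open>p \<mapsto> k \<circ> p\<close> have the cardinality of the stabilizer of \<open>k\<close>.\<close>
lemma sum_permutes_eq_sum_fibre_sizes:
  fixes F :: "(nat \<Rightarrow> nat) \<Rightarrow> 'c::comm_ring_1"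
  assumes k: "k \<in> {..<n} \<rightarrow> {..<n}"
  shows "\<exists>c>0. (\<Sum>p | p permutes {..<n}. F (restrict (k \<circ> p) {..<n})) =
    of_nat c * (\<Sum>f \<in> {f \<in> {..<n} \<rightarrow>\<^sub>E {..<n}. \<forall>i<n. card {j\<in>{..<n}. f j = i} = card {j\<in>{..<n}. k j = i}}. F f)"
proof -
  let ?A = "{..<n}"
  let ?P = "{p. p permutes ?A}"
  let ?R = "\<lambda>p. restrict (k \<circ> p) ?A"
  let ?T = "{f \<in> ?A \<rightarrow>\<^sub>E ?A. \<forall>i<n. card {j\<in>?A. f j = i} = card {j\<in>?A. k j = i}}"
  let ?S = "{q \<in> ?P. \<forall>j\<in>?A. k (q j) = k j}"
  have finP: "finite ?P" by (simp add: finite_permutations)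
  have finT: "finite ?T" by (rule finite_subset[of _ "?A \<rightarrow>\<^sub>E ?A"]) (auto simp: finite_PiE)
  have img: "?R ` ?P \<subseteq> ?T"
  proof (rule image_subsetI)
    fix p assume "p \<in> ?P"
    then have p: "p permutes ?A" by simp
    have "?R p \<in> ?A \<rightarrow>\<^sub>E ?A" using k permutes_in_image[OF p] by auto
    moreover have "card {j\<in>?A. ?R p j = i} = card {j\<in>?A. k j = i}" for i
    proof -
    have "{j\<in>?A. k j = i} = p ` {j\<in>?A. ?R p j = i}"
    proof (safe)
      fix j assume j: "j < n"
      have "inv_into UNIV p j < n" "p (inv_into UNIV p j) = j"
        using permutes_in_image[OF permutes_inv[OF p], of j] permutes_inverses[OF p] j by auto
      then show "j \<in> p ` {ja \<in> {..<n}. ?R p ja = k j}"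
        by (intro image_eqI[of _ _ "inv_into UNIV p j"]) auto
    qed (use permutes_in_image[OF p] in auto)
    then show ?thesis
      by (simp add: card_image permutes_inj_on[OF p])
    qed
    ultimately show "?R p \<in> ?T" by simp
  qed
  have fib: "card {p \<in> ?P. ?R p = f} = card ?S" if f: "f \<in> ?T" for f
  proof -
    \<comment> \<open>Equal fibre sizes mean equal multisets of values; this yields a permutation
      \<open>p0\<close> relating \<open>f\<close> to \<open>k\<close>.\<close>
    have "image_mset f (mset_set ?A) = image_mset k (mset_set ?A)"
    proof (rule multiset_eqI)
      fix i
      have c: "count (image_mset g (mset_set ?A)) i = card {j\<in>?A. g j = i}" for g :: "nat \<Rightarrow> nat"
        by (simp add: count_image_mset vimage_def Int_def conj_commute)
      show "count (image_mset f (mset_set ?A)) i = count (image_mset k (mset_set ?A)) i"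
      proof (cases "i < n")
        case False
        then have "{j\<in>?A. f j = i} = {}" "{j\<in>?A. k j = i} = {}"
          using f k by (auto simp: PiE_def Pi_def)
        then show ?thesis unfolding c by (simp only:)
      qed (use f in \<open>simp add: c\<close>)
    qed
    then obtain p0 where p0: "p0 permutes ?A" "\<forall>x\<in>?A. f x = k (p0 x)"
      using image_mset_eq_implies_permutes[of ?A f k] by auto
    have f_eq: "?R p0 = f" using p0 f by (auto simp: PiE_def extensional_def fun_eq_iff restrict_def)
    \<comment> \<open>The permutations producing \<open>f\<close> form a coset of the stabilizer of
      \<open>k\<close>.\<close>
    have "bij_betw (\<lambda>q. q \<circ> p0) ?S {p \<in> ?P. ?R p = f}"
    proof (rule bij_betw_byWitness[where f' = "\<lambda>p. p \<circ> inv_into UNIV p0"])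
      show "\<forall>a\<in>?S. a \<circ> p0 \<circ> inv_into UNIV p0 = a" "\<forall>a'\<in>{p \<in> ?P. ?R p = f}. a' \<circ> inv_into UNIV p0 \<circ> p0 = a'"
        using permutes_inv_o[OF p0(1)] by (auto simp: comp_assoc)
      show "(\<lambda>q. q \<circ> p0) ` ?S \<subseteq> {p \<in> ?P. ?R p = f}"
      proof safe
        fix q assume q: "q permutes ?A" "\<forall>j\<in>?A. k (q j) = k j"
        show "q \<circ> p0 permutes ?A" using p0 q by (intro permutes_compose)
        show "?R (q \<circ> p0) = f"
          unfolding f_eq[symmetric] using q permutes_in_image[OF p0(1)] by (intro restrict_ext) auto
      qed
      show "(\<lambda>p. p \<circ> inv_into UNIV p0) ` {p \<in> ?P. ?R p = f} \<subseteq> ?S"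
      proof (rule image_subsetI)
        fix p assume p: "p \<in> {p \<in> ?P. ?R p = f}"
        then have "p \<circ> inv_into UNIV p0 permutes ?A" using p0 by (intro permutes_compose permutes_inv) auto
        moreover have "k ((p \<circ> inv_into UNIV p0) j) = k j" if j: "j \<in> ?A" for j
        proof -
          have j': "inv_into UNIV p0 j \<in> ?A" "p0 (inv_into UNIV p0 j) = j"
            using permutes_in_image[OF permutes_inv[OF p0(1)]] permutes_inverses[OF p0(1)] j by auto
          have "?R p (inv_into UNIV p0 j) = f (inv_into UNIV p0 j)" using p by simp
          then show ?thesis using j' p0(2) by simp
        qed
        ultimately show "p \<circ> inv_into UNIV p0 \<in> ?S" by simp
      qed
    qed
    then show ?thesis by (simp add: bij_betw_same_card)
  qed
  have "(\<Sum>p\<in>?P. F (?R p)) = (\<Sum>f\<in>?T. \<Sum>p\<in>{p \<in> ?P. ?R p = f}. F (?R p))"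
    using sum.group[OF finP finT img, of "\<lambda>p. F (?R p)"] by simp
  also have "\<dots> = (\<Sum>f\<in>?T. of_nat (card ?S) * F f)"
  proof (rule sum.cong[OF refl])
    fix f assume f: "f \<in> ?T"
    have "(\<Sum>p\<in>{p \<in> ?P. ?R p = f}. F (?R p)) = (\<Sum>p\<in>{p \<in> ?P. ?R p = f}. F f)"
      by (rule sum.cong) auto
    then show "(\<Sum>p\<in>{p \<in> ?P. ?R p = f}. F (?R p)) = of_nat (card ?S) * F f"
      using fib[OF f] by simp
  qed
  finally have "(\<Sum>p\<in>?P. F (?R p)) = of_nat (card ?S) * (\<Sum>f\<in>?T. F f)"
    by (simp add: sum_distrib_left)
  moreover have "card ?S > 0"
  proof -
    have "id \<in> ?S" by (auto intro: permutes_id)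
    moreover have "finite ?S" using finP by simp
    ultimately show ?thesis using card_gt_0_iff by blast
  qed
  ultimately show ?thesis by blast
qed

text \<open>Up to a nonzero factor the amplitude is the permanent of \<open>U\<close> with row
  \<open>i\<close> repeated \<open>s ! i\<close> times: neither the stabilizer count nor the square
  root of the factorials vanishes.\<close>

lemma fock_amp_eq_0_iff_inj_sum:
  assumes k: "\<And>j. j < n \<Longrightarrow> k j < n" and s: "\<And>i. i < n \<Longrightarrow> s ! i = card {j\<in>{..<n}. k j = i}"
  shows "fock_amp n U s = 0 \<longleftrightarrow> inj_sum {..<n} (\<lambda>i x. U (k i) x) {..<n} = 0"
proof -
  let ?F = "\<lambda>f. \<Prod>j<n. U (f j) j"
  let ?T = "{f \<in> {..<n} \<rightarrow>\<^sub>E {..<n}. \<forall>i<n. card {j\<in>{..<n}. f j = i} = card {j\<in>{..<n}. k j = i}}"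
  obtain c where c: "c > 0" "(\<Sum>p | p permutes {..<n}. ?F (restrict (k \<circ> p) {..<n})) = of_nat c * (\<Sum>f\<in>?T. ?F f)"
    using sum_permutes_eq_sum_fibre_sizes[of k n ?F] k by auto
  \<comment> \<open>\<open>fock_amp\<close> assigns a row to each column, \<open>inj_sum\<close> a
    column to each row; hence the passage to inverse permutations.\<close>
  have "inj_sum {..<n} (\<lambda>i x. U (k i) x) {..<n} = (\<Sum>p | p permutes {..<n}. \<Prod>i<n. U (k i) (inv_into UNIV p i))"
    by (subst inj_sum_eq_sum_permutes, simp, subst sum_permutations_inverse, rule refl)
  also have "\<dots> = (\<Sum>p | p permutes {..<n}. ?F (restrict (k \<circ> p) {..<n}))"
  proof (intro sum.cong refl)
    fix p assume "p \<in> {p. p permutes {..<n}}"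
    then have p: "p permutes {..<n}" by simp
    have "(\<Prod>i<n. U (k i) (inv_into UNIV p i)) = (\<Prod>j<n. U (k (p j)) (inv_into UNIV p (p j)))"
      using prod.permute[OF p, of "\<lambda>i. U (k i) (inv_into UNIV p i)"] by (simp add: o_def)
    also have "\<dots> = ?F (restrict (k \<circ> p) {..<n})"
      by (intro prod.cong refl) (simp add: permutes_inverses[OF p])
    finally show "(\<Prod>i<n. U (k i) (inv_into UNIV p i)) = ?F (restrict (k \<circ> p) {..<n})" .
  qed
  finally have "inj_sum {..<n} (\<lambda>i x. U (k i) x) {..<n} = of_nat c * (\<Sum>f\<in>?T. ?F f)"
    using c by simp
  moreover have "{f. f \<in> {..<n} \<rightarrow>\<^sub>E {..<n} \<and> (\<forall>i<n. card {j\<in>{..<n}. f j = i} = s ! i)} = ?T"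
    using s by auto
  moreover have "real (\<Prod>i<n. fact (s ! i)) \<noteq> 0" by simp
  ultimately show ?thesis
    using c(1) unfolding fock_amp_def by simp
qed

section \<open>Sums over distinct roots of unity\<close>

definition unity :: "nat \<Rightarrow> int \<Rightarrow> complex" where
  "unity n a = cis (2 * pi * of_int a / real n)"

lemma unity_add: "unity n (a + b) = unity n a * unity n b"
  by (simp add: unity_def cis_mult add_divide_distrib ring_distribs)

lemma unity_0 [simp]: "unity n 0 = 1"
  by (simp add: unity_def)

lemma unity_sum: "unity n (\<Sum>i\<in>A. f i) = (\<Prod>i\<in>A. unity n (f i))"
  by (induction A rule: infinite_finite_induct) (simp_all add: unity_add)

lemma unity_power: "unity n a ^ k = unity n (a * int k)"
  by (induction k) (simp_all add: unity_add ring_distribs)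

lemma unity_eq_1_iff:
  assumes "n > 0"
  shows "unity n a = 1 \<longleftrightarrow> int n dvd a"
proof
  assume "unity n a = 1"
  then have "cos (2 * pi * of_int a / real n) = 1"
    by (metis unity_def cis.sel(1) one_complex.sel(1))
  then obtain m :: int where "2 * pi * of_int a / real n = of_int m * 2 * pi"
    using cos_one_2pi_int by blast
  then have "real_of_int a = of_int (m * int n)" using assms by (simp add: field_simps)
  then have "a = m * int n" by (simp only: of_int_eq_iff)
  then show "int n dvd a" by simp
next
  assume "int n dvd a"
  then obtain m where "a = int n * m" by blast
  then have "unity n a = cis (2 * pi * of_int m)" using assms by (simp add: unity_def mult.assoc)
  also have "\<dots> = 1" by (rule cis_multiple_2pi) simp
  finally show "unity n a = 1" .
qed

lemma sum_unity:
  assumes "n > 0"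
  shows "(\<Sum>x<n. unity n (a * int x)) = (if int n dvd a then of_nat n else 0)"
proof -
  have eq: "(\<Sum>x<n. unity n (a * int x)) = (\<Sum>x<n. unity n a ^ x)"
    by (simp add: unity_power)
  show ?thesis
  proof (cases "int n dvd a")
    case True
    then have "unity n a = 1" using unity_eq_1_iff[OF assms] by simp
    then show ?thesis unfolding eq using True by simp
  next
    case False
    then have "unity n a \<noteq> 1" using unity_eq_1_iff[OF assms] by simp
    moreover have "unity n a ^ n = 1"
      unfolding unity_power using unity_eq_1_iff[OF assms] by simp
    ultimately show ?thesis unfolding eq using False by (simp add: sum_gp_strict)
  qed
qed

text \<open>This is the augmented monomial symmetric function with exponents \<open>k\<close>,
  evaluated at the \<open>n\<close>-th roots of unity. Integer exponents make room for shifts and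
  negative values.\<close>

definition root_sum :: "nat \<Rightarrow> ('a \<Rightarrow> int) \<Rightarrow> 'a set \<Rightarrow> complex" where
  "root_sum n k I = inj_sum {..<n} (\<lambda>i x. unity n (k i * int x)) I"

lemma root_sum_empty [simp]: "root_sum n k {} = 1"
  by (simp add: root_sum_def)

text \<open>Each block contributes a power sum over all \<open>n\<close>-th roots of unity, which is
  \<open>n\<close> when the exponents of the block sum to 0 modulo \<open>n\<close> and vanishes
  otherwise.\<close>

lemma root_sum_expansion:
  assumes "n > 0" "finite J" "i \<notin> J"
  shows "root_sum n k (insert i J) =
    (\<Sum>C \<in> {C \<in> Pow J. int n dvd k i + (\<Sum>c\<in>C. k c)}.
       of_int ((-1) ^ card C * int (fact (card C) * n)) * root_sum n k (J - C))"
proof -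
  have "(\<Sum>x<n. \<Prod>j\<in>insert i C. unity n (k j * int x)) =
      (if int n dvd k i + (\<Sum>c\<in>C. k c) then of_nat n else 0)" if "C \<subseteq> J" for C
  proof -
    have "finite C" "i \<notin> C" using that assms finite_subset by auto
    then have "(\<Prod>j\<in>insert i C. unity n (k j * int x)) = unity n ((k i + (\<Sum>c\<in>C. k c)) * int x)" for x
      unfolding unity_sum[symmetric] sum_distrib_right[symmetric] by simp
    then show ?thesis using sum_unity[OF assms(1)] by simp
  qed
  then have "root_sum n k (insert i J) = (\<Sum>C \<in> Pow J. if int n dvd k i + (\<Sum>c\<in>C. k c)
      then of_int ((-1) ^ card C * int (fact (card C) * n)) * root_sum n k (J - C) else 0)"
    unfolding root_sum_def inj_sum_block_expansion[OF finite_lessThan assms(2,3)]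
    by (intro sum.cong refl) (simp add: mult_ac)
  then show ?thesis using assms(2) by (simp add: sum.If_cases Int_def)
qed

text \<open>A zero exponent gives a row of ones, so the extra position only multiplies by a
  scalar.\<close>

lemma root_sum_eq_0_insert:
  assumes "finite I" "i \<notin> I" "k i = 0" "root_sum n k I = 0"
  shows "root_sum n k (insert i I) = 0"
  using assms inj_sum_insert_one[of "{..<n}" I i "\<lambda>i x. unity n (k i * int x)"]
  by (simp add: root_sum_def)

text \<open>Some term of the expansion must be nonzero. It splits off a zero-sum block, and the
  other positions are zero-sum by induction. This is the half of the law valid for every
  \<open>n\<close>.\<close>

lemma root_sum_nonzero_imp_dvd:
  assumes "n > 0" "finite I" "root_sum n k I \<noteq> 0"
  shows "int n dvd (\<Sum>i\<in>I. k i)"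
  using assms(2,3)
proof (induction I rule: finite_psubset_induct)
  case (psubset I)
  show ?case
  proof (cases "I = {}")
    case False
    then obtain i J where iJ: "I = insert i J" "i \<notin> J" by (meson Set.set_insert ex_in_conv)
    have fJ: "finite J" using psubset.hyps iJ by simp
    obtain C where C: "C \<subseteq> J" "int n dvd k i + (\<Sum>c\<in>C. k c)" "root_sum n k (J - C) \<noteq> 0"
    proof (rule ccontr)
      assume "\<not> thesis"
      then have "root_sum n k (insert i J) = 0"
        unfolding root_sum_expansion[OF assms(1) fJ iJ(2)] using that by (intro sum.neutral) auto
      then show False using psubset.prems iJ by simp
    qed
    have "int n dvd (\<Sum>i\<in>J - C. k i)"
      using C iJ by (intro psubset.IH) auto
    moreover have "(\<Sum>i\<in>I. k i) = (k i + (\<Sum>c\<in>C. k c)) + (\<Sum>i\<in>J - C. k i)"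
      using iJ fJ C by (simp add: sum.subset_diff[of C J])
    ultimately show ?thesis using C(2) by (simp only: dvd_add)
  qed simp
qed

text \<open>Shifting all exponents multiplies the sum by a root of unity, since every injection is onto.\<close>
lemma fock_amp_fourier_eq_0_iff:
  assumes n: "n > 0" and k: "\<And>j. j < n \<Longrightarrow> k j < n"
    and s: "\<And>i. i < n \<Longrightarrow> s ! i = card {j\<in>{..<n}. k j = i}"
  shows "fock_amp n (fourier n) s = 0 \<longleftrightarrow> root_sum n (\<lambda>i. int (k i) - d) {..<n} = 0"
proof -
  define h where "h x = unity n (d * int x) / complex_of_real (sqrt (real n))" for x
  have "inj_sum {..<n} (\<lambda>i x. fourier n (k i) x) {..<n} =
      inj_sum {..<n} (\<lambda>i x. h x * unity n ((int (k i) - d) * int x)) {..<n}"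
  proof (intro inj_sum_cong)
    fix i x
    have "h x * unity n ((int (k i) - d) * int x) = unity n (int (k i) * int x) / complex_of_real (sqrt (real n))"
      by (simp add: h_def flip: unity_add) (simp add: algebra_simps)
    then show "fourier n (k i) x = h x * unity n ((int (k i) - d) * int x)"
      by (simp add: fourier_def unity_def)
  qed
  also have "\<dots> = (\<Prod>x<n. h x) * root_sum n (\<lambda>i. int (k i) - d) {..<n}"
    unfolding root_sum_def by (rule inj_sum_mult_value) auto
  finally have "inj_sum {..<n} (\<lambda>i x. fourier n (k i) x) {..<n} = \<dots>" .
  moreover have "h x \<noteq> 0" for x using n by (simp add: h_def unity_def)
  ultimately show ?thesis using fock_amp_eq_0_iff_inj_sum[of n k s "fourier n"] k s by simp
qed

section \<open>From occupation numbers to lists of modes\<close>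

lemma sum_card_fibres:
  fixes k g :: "nat \<Rightarrow> nat"
  assumes "k \<in> {..<n} \<rightarrow> {..<n}"
  shows "(\<Sum>i<n. g i * card {j\<in>{..<n}. k j = i}) = (\<Sum>j<n. g (k j))"
proof -
  have "(\<Sum>j<n. g (k j)) = (\<Sum>i<n. \<Sum>j\<in>{j\<in>{..<n}. k j = i}. g (k j))"
    using assms by (subst sum.group) auto
  also have "\<dots> = (\<Sum>i<n. \<Sum>j\<in>{j\<in>{..<n}. k j = i}. g i)"
    by (intro sum.cong) auto
  finally show ?thesis by (simp add: mult.commute)
qed

text \<open>Listing mode \<open>i\<close> with multiplicity \<open>s ! i\<close> gives one exponent
  per photon, and the weighted sum of the law becomes the sum of these exponents.\<close>

lemma exists_enumeration:
  assumes "length s = n" "sum_list s = n"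
  obtains k :: "nat \<Rightarrow> nat" where "\<And>j. j < n \<Longrightarrow> k j < n"
    "\<And>i. i < n \<Longrightarrow> s ! i = card {j\<in>{..<n}. k j = i}" "(\<Sum>j<n. k j) = (\<Sum>i<n. i * s ! i)"
proof -
  define L where "L = concat (map (\<lambda>i. replicate (s ! i) i) [0..<n])"
  have len: "length L = n"
    using assms by (simp add: L_def length_concat o_def map_nth flip: assms(1))
  have count: "count_list L i = (if i < n then s ! i else 0)" for i
  proof -
    have "count_list (replicate m j) i = (if i = j then m else 0)" for m j
      by (induction m) auto
    then have "count_list L i = (\<Sum>j\<leftarrow>[0..<n]. if i = j then s ! j else 0)"
      by (simp add: L_def count_list_concat o_def)
    also have "\<dots> = (\<Sum>j<n. if i = j then s ! j else 0)"
      by (simp add: interv_sum_list_conv_sum_set_nat atLeast0LessThan)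
    finally show ?thesis by simp
  qed
  have "set L \<subseteq> {..<n}" by (auto simp: L_def)
  then have lt: "L ! j < n" if "j < n" for j using that len nth_mem by fastforce
  have card: "s ! i = card {j\<in>{..<n}. L ! j = i}" if "i < n" for i
    using count[of i] that len by (simp add: count_list_eq_length_filter length_filter_conv_card eq_commute conj_commute)
  have "(\<Sum>i<n. i * s ! i) = (\<Sum>i<n. i * card {j\<in>{..<n}. L ! j = i})"
    using card by (intro sum.cong) auto
  also have "\<dots> = (\<Sum>j<n. L ! j)"
    using sum_card_fibres[of "(!) L" n "\<lambda>i. i"] lt by auto
  finally show ?thesis using that[of "(!) L"] lt card by simp
qed

section \<open>Prime powers\<close>

text \<open>Integrality together with \<open>p\<close>-adic valuation at least
  \<open>m / (p - 1)\<close>, written without fractions. Taking \<open>v\<close> as a witness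
  instead of a multiplicity lets 0 meet every bound when \<open>p\<close> is prime.\<close>

definition padic_bound :: "nat \<Rightarrow> nat \<Rightarrow> complex \<Rightarrow> bool" where
  "padic_bound p m c \<longleftrightarrow> (\<exists>z v. c = of_int z \<and> int p ^ v dvd z \<and> m \<le> (p - 1) * v)"

lemma padic_bound_add:
  assumes "padic_bound p m a" "padic_bound p m b"
  shows "padic_bound p m (a + b)"
proof -
  obtain y v z w where *: "a = of_int y" "int p ^ v dvd y" "m \<le> (p - 1) * v"
    "b = of_int z" "int p ^ w dvd z" "m \<le> (p - 1) * w"
    using assms unfolding padic_bound_def by blast
  have "int p ^ min v w dvd y" "int p ^ min v w dvd z"
    using * by (meson dvd_trans le_imp_power_dvd min.cobounded1 min.cobounded2)+
  then have "int p ^ min v w dvd y + z" by simp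
  moreover have "m \<le> (p - 1) * min v w" using * by (simp add: min_def)
  ultimately show ?thesis
    unfolding padic_bound_def using * by (intro exI[of _ "y + z"] exI[of _ "min v w"]) simp
qed

lemma padic_bound_mult:
  assumes "padic_bound p m a" "padic_bound p l b"
  shows "padic_bound p (m + l) (a * b)"
proof -
  obtain y v z w where *: "a = of_int y" "int p ^ v dvd y" "m \<le> (p - 1) * v"
    "b = of_int z" "int p ^ w dvd z" "l \<le> (p - 1) * w"
    using assms unfolding padic_bound_def by blast
  then show ?thesis
    unfolding padic_bound_def
    by (intro exI[of _ "y * z"] exI[of _ "v + w"])
       (auto simp: power_add mult_dvd_mono distrib_left intro: add_mono)
qed

lemma padic_bound_0:
  assumes "prime p"
  shows "padic_bound p m 0"
  using prime_gt_1_nat[OF assms]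
  unfolding padic_bound_def by (intro exI[of _ 0] exI[of _ m]) auto

lemma padic_bound_sum:
  assumes "prime p" "\<And>i. i \<in> A \<Longrightarrow> padic_bound p m (f i)"
  shows "padic_bound p m (\<Sum>i\<in>A. f i)"
  using assms(2)
  by (induction A rule: infinite_finite_induct)
     (auto intro: padic_bound_0[OF assms(1)] padic_bound_add)

text \<open>Legendre's formula as a recursion: only the \<open>m div p\<close> multiples of
  \<open>p\<close> count, each with one factor \<open>p\<close> and those of its quotient by
  \<open>p\<close>.\<close>

lemma multiplicity_fact:
  fixes p :: nat
  assumes p: "prime p"
  shows "multiplicity p (fact m) = m div p + multiplicity p (fact (m div p))"
proof (induction m)
  case (Suc m)
  have step: "multiplicity p (fact (Suc r)) = multiplicity p (Suc r) + multiplicity p (fact r)" for r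
    unfolding fact_Suc of_nat_id using p by (intro prime_elem_multiplicity_mult_distrib) auto
  show ?case
  proof (cases "p dvd Suc m")
    case True
    then obtain c where c: "Suc m = p * c" by blast
    then obtain d where d: "c = Suc d" by (cases c) auto
    have "multiplicity p (Suc m) = Suc (multiplicity p (Suc d))"
      unfolding c d using p by (intro multiplicity_times_same) auto
    moreover have "Suc m div p = Suc d" using c d prime_gt_0_nat[OF p] by simp
    moreover have "m div p = d" using True calculation(2) by (simp add: div_Suc dvd_eq_mod_eq_0)
    ultimately show ?thesis using Suc.IH step by simp
  next
    case False
    then have "multiplicity p (Suc m) = 0" by (rule not_dvd_imp_multiplicity_0)
    moreover have "Suc m div p = m div p" using False by (simp add: div_Suc dvd_eq_mod_eq_0)
    ultimately show ?thesis using Suc.IH step[of m] by simp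
  qed
qed simp

text \<open>Induction on \<open>k\<close>, passing from \<open>m\<close> to \<open>m div p\<close>
  by Legendre's recursion. These are the valuations of the weights of blocks of size
  \<open>Suc m\<close> when \<open>n = p ^ k\<close>: only the full block falls below size divided
  by \<open>p - 1\<close>, and this deficit prevents cancellation.\<close>

lemma multiplicity_fact_bounds:
  fixes p :: nat
  assumes p: "prime p"
  shows "(Suc m < p ^ k \<longrightarrow> Suc m \<le> (p - 1) * (k + multiplicity p (fact m))) \<and>
    (Suc m = p ^ k \<longrightarrow> (p - 1) * (k + multiplicity p (fact m)) = m)"
proof (induction k arbitrary: m)
  case (Suc k)
  define c where "c = m div p"
  define v where "v = multiplicity p (fact c)"
  define q where "q = p - 1"
  have q: "p = Suc q" "q > 0" using prime_gt_1_nat[OF p] by (auto simp: q_def)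
  have m: "m < p * Suc c"
    unfolding c_def using prime_gt_0_nat[OF p] by (simp add: dividend_less_times_div)
  have lhs: "(p - 1) * (Suc k + multiplicity p (fact m)) = q * (k + v) + q * Suc c"
    unfolding multiplicity_fact[OF p, of m] c_def[symmetric] v_def[symmetric] by (simp add: q algebra_simps)
  have IH: "Suc c < p ^ k \<Longrightarrow> Suc c \<le> q * (k + v)" "Suc c = p ^ k \<Longrightarrow> q * (k + v) = c"
    using Suc.IH[of c] by (auto simp: q v_def)
  have pc: "p * Suc c = Suc c + q * Suc c" by (simp add: q)
  show ?case
  proof (intro conjI impI)
    assume lt: "Suc m < p ^ Suc k"
    have "p * c \<le> m" by (simp add: c_def)
    moreover have "m < p * p ^ k" using lt by simp
    ultimately have "p * c < p * p ^ k" by (rule le_less_trans)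
    then have "Suc c \<le> p ^ k" by simp
    then consider "Suc c < p ^ k" | "Suc c = p ^ k" by linarith
    then have "Suc m \<le> q * (k + v) + q * Suc c"
    proof cases
      case 1
      then show ?thesis using IH(1) m pc by linarith
    next
      \<comment> \<open>Here the induction hypothesis only yields \<open>c\<close>, one less than in
        the other case; \<open>Suc m < p ^ Suc k\<close> makes up for it.\<close>
      case 2
      have "p ^ Suc k = Suc c + q * Suc c" using 2 pc by simp
      then show ?thesis using IH(2)[OF 2] lt by linarith
    qed
    then show "Suc m \<le> (p - 1) * (Suc k + multiplicity p (fact m))" using lhs by simp
  next
    assume eq: "Suc m = p ^ Suc k"
    then have "p * c \<le> m" "m < p * p ^ k" by (auto simp: c_def)
    then have "p * c < p * p ^ k" by linarith
    then have "Suc c \<le> p ^ k" by simp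
    moreover have "p * p ^ k \<le> p * Suc c" using eq m by simp
    then have "p ^ k \<le> Suc c" using q by (simp only: mult_le_cancel1)
    ultimately have 2: "Suc c = p ^ k" by simp
    have "p ^ Suc k = Suc c + q * Suc c" using 2 pc by simp
    then show "(p - 1) * (Suc k + multiplicity p (fact m)) = m"
      using IH(2)[OF 2] eq lhs by linarith
  qed
qed simp

lemma multiplicity_fact_times_prime_power:
  fixes p :: nat
  assumes "prime p"
  shows "multiplicity p (fact c * p ^ k) = k + multiplicity p (fact c)"
  using assms by (subst prime_elem_multiplicity_mult_distrib) auto

lemma padic_bound_block:
  assumes p: "prime p" and "Suc c < p ^ k"
  shows "padic_bound p (Suc c) (of_int ((-1) ^ c * int (fact c * p ^ k)))"
proof -
  let ?v = "k + multiplicity p (fact c)"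
  have "p ^ ?v dvd fact c * p ^ k"
    using multiplicity_dvd[of p "fact c * p ^ k"] multiplicity_fact_times_prime_power[OF p] by simp
  then have "int p ^ ?v dvd int (fact c * p ^ k)"
    by (metis of_nat_dvd_iff of_nat_power)
  then show ?thesis
    using multiplicity_fact_bounds[OF p, of c k] assms(2) unfolding padic_bound_def
    by (intro exI[of _ "(-1) ^ c * int (fact c * p ^ k)"] exI[of _ ?v]) (auto intro: dvd_mult)
qed

text \<open>All blocks have fewer than \<open>p ^ k\<close> elements, so each obeys the bound
  proportional to its size, and the sizes add up to \<open>card I\<close>.\<close>

lemma root_sum_padic_bound:
  assumes p: "prime p" and "finite I" "card I < p ^ k"
  shows "padic_bound p (card I) (root_sum (p ^ k) a I)"
  using assms(2,3)
proof (induction I rule: finite_psubset_induct)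
  case (psubset I)
  have n: "p ^ k > 0" using prime_gt_0_nat[OF p] by simp
  show ?case
  proof (cases "I = {}")
    case True
    then show ?thesis unfolding padic_bound_def by (intro exI[of _ 1] exI[of _ 0]) simp
  next
    case False
    then obtain i J where iJ: "I = insert i J" "i \<notin> J" by (meson Set.set_insert ex_in_conv)
    have fJ: "finite J" using psubset.hyps iJ by simp
    show ?thesis
      unfolding iJ(1) root_sum_expansion[OF n fJ iJ(2)]
    proof (rule padic_bound_sum[OF p])
      fix C assume "C \<in> {C \<in> Pow J. int (p ^ k) dvd a i + (\<Sum>c\<in>C. a c)}"
      then have C: "C \<subseteq> J" by simp
      have fC: "finite C" using C fJ finite_subset by auto
      have le: "card C \<le> card J" using C fJ card_mono by blast
      have "card I = Suc (card J)" using iJ fJ by simp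
      then have "padic_bound p (Suc (card C)) (of_int ((-1) ^ card C * int (fact (card C) * p ^ k)))"
        using psubset.prems le by (intro padic_bound_block[OF p]) simp
      moreover have "padic_bound p (card (J - C)) (root_sum (p ^ k) a (J - C))"
        using psubset.prems iJ C fJ
        by (intro psubset.IH) (auto intro: le_less_trans[OF card_mono])
      ultimately have "padic_bound p (Suc (card C) + card (J - C))
          (of_int ((-1) ^ card C * int (fact (card C) * p ^ k)) * root_sum (p ^ k) a (J - C))"
        by (rule padic_bound_mult)
      moreover have "Suc (card C) + card (J - C) = card (insert i J)"
        using iJ fJ C le fC by (simp add: card_Diff_subset)
      ultimately show "padic_bound p (card (insert i J))
          (of_int ((-1) ^ card C * int (fact (card C) * p ^ k)) * root_sum (p ^ k) a (J - C))"
        by simp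
    qed
  qed
qed

text \<open>The full block contributes \<open>\<plusminus>n!\<close>, of \<open>p\<close>-adic valuation \<open>(n - 1) / (p - 1)\<close>, while all other
  blocks contribute terms of valuation at least \<open>n / (p - 1)\<close>.\<close>
theorem root_sum_prime_power_nonzero:
  assumes p: "prime p" and I: "finite I" "card I = p ^ k"
    and dvd: "int (p ^ k) dvd (\<Sum>i\<in>I. a i)"
  shows "root_sum (p ^ k) a I \<noteq> 0"
proof
  assume eq0: "root_sum (p ^ k) a I = 0"
  have n: "p ^ k > 0" using prime_gt_0_nat[OF p] by simp
  then have "I \<noteq> {}" using I by auto
  then obtain i J where iJ: "I = insert i J" "i \<notin> J" by (meson Set.set_insert ex_in_conv)
  have fJ: "finite J" using I iJ by simp
  have cJ: "Suc (card J) = p ^ k" using I iJ fJ by simp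
  define S where "S = {C \<in> Pow J. int (p ^ k) dvd a i + (\<Sum>c\<in>C. a c)}"
  define T where "T C = of_int ((-1) ^ card C * int (fact (card C) * p ^ k)) * root_sum (p ^ k) a (J - C)" for C
  have S: "finite S" "J \<in> S" using fJ dvd iJ by (auto simp: S_def)
  have "0 = (\<Sum>C\<in>S. T C)"
    using eq0 unfolding iJ(1) root_sum_expansion[OF n fJ iJ(2)] S_def T_def by simp
  also have "\<dots> = T J + (\<Sum>C\<in>S - {J}. T C)" using S by (simp add: sum.remove)
  finally have rest: "(\<Sum>C\<in>S - {J}. T C) = - T J" by (simp add: eq_neg_iff_add_eq_0 add.commute)
  \<comment> \<open>For proper \<open>C\<close> the block \<open>insert i C\<close> has fewer than
    \<open>p ^ k\<close> elements. So has \<open>J - C\<close>, even for empty \<open>C\<close>,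
    since \<open>i\<close> is missing from it.\<close>
  have "padic_bound p (Suc (card J)) (\<Sum>C\<in>S - {J}. T C)"
  proof (rule padic_bound_sum[OF p])
    fix C assume "C \<in> S - {J}"
    then have C: "C \<subset> J" by (auto simp: S_def)
    have lt: "card C < card J" using psubset_card_mono[OF fJ C] .
    have fC: "finite C" using C fJ finite_subset by auto
    have "padic_bound p (Suc (card C)) (of_int ((-1) ^ card C * int (fact (card C) * p ^ k)))"
      using lt cJ by (intro padic_bound_block[OF p]) simp
    moreover have "padic_bound p (card (J - C)) (root_sum (p ^ k) a (J - C))"
    proof (rule root_sum_padic_bound[OF p])
      have "card (J - C) \<le> card J" using fJ by (intro card_mono) auto
      then show "card (J - C) < p ^ k" using cJ by simp
    qed (use fJ in simp)
    ultimately have "padic_bound p (Suc (card C) + card (J - C)) (T C)"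
      unfolding T_def by (rule padic_bound_mult)
    moreover have "Suc (card C) + card (J - C) = Suc (card J)"
      using fJ C lt fC by (simp add: card_Diff_subset psubset_imp_subset)
    ultimately show "padic_bound p (Suc (card J)) (T C)" by simp
  qed
  then obtain z v where zv: "- T J = of_int z" "int p ^ v dvd z" "Suc (card J) \<le> (p - 1) * v"
    unfolding rest padic_bound_def by blast
  have "of_int (- ((-1) ^ card J * int (fact (card J) * p ^ k))) = (of_int z :: complex)"
    using zv(1) by (simp add: T_def)
  then have "z = - ((-1) ^ card J * int (fact (card J) * p ^ k))"
    by (simp only: of_int_eq_iff)
  moreover have "\<bar>(-1 :: int) ^ card J\<bar> = 1" by (simp add: power_abs)
  ultimately have "\<bar>z\<bar> = int (fact (card J) * p ^ k)" by (simp only: abs_minus_cancel abs_mult abs_of_nat mult_1)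
  then have "int p ^ v dvd int (fact (card J) * p ^ k)" using zv(2) by (metis dvd_abs_iff)
  then have "p ^ v dvd fact (card J) * p ^ k" by (metis of_nat_dvd_iff of_nat_power)
  then have "v \<le> multiplicity p (fact (card J) * p ^ k)"
    using p by (intro multiplicity_geI) auto
  \<comment> \<open>The other terms force \<open>Suc (card J) <= (p - 1) * v\<close>, while the full
    block allows only \<open>card J\<close>.\<close>
  then have "(p - 1) * v \<le> (p - 1) * (k + multiplicity p (fact (card J)))"
    using multiplicity_fact_times_prime_power[OF p] by (intro mult_le_mono2) simp
  also have "\<dots> = card J" using multiplicity_fact_bounds[OF p, of "card J" k] cJ by simp
  finally show False using zv(3) by simp
qed

section \<open>Numbers that are not prime powers\<close>

text \<open>Write \<open>n = a * b\<close> with \<open>a\<close> the full power of a prime factor,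
  and take \<open>t\<close> to be 0 modulo \<open>a\<close> and 1 modulo \<open>b\<close> by Chinese
  remaindering. As \<open>n\<close> is no prime power, \<open>b > 1\<close>; with
  \<open>a > 1\<close> this excludes \<open>t = 0\<close> and \<open>t = 1\<close>.\<close>

lemma exists_nontrivial_idempotent_mod:
  fixes n :: nat
  assumes "n \<ge> 2" "\<not> primepow n"
  shows "\<exists>t. 1 < t \<and> t < n \<and> n dvd t * (t - 1)"
proof -
  obtain p where p: "prime p" "p dvd n" using assms prime_factor_nat[of n] by auto
  have "n \<noteq> 0" "\<not> is_unit p" using assms(1) p by auto
  then obtain b where b: "n = p ^ multiplicity p n * b" "\<not> p dvd b"
    by (rule multiplicity_decompose'[of n p])
  define a where "a = p ^ multiplicity p n"
  have "multiplicity p n > 0" using p assms by (simp add: prime_multiplicity_gt_zero_iff)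
  then have "a > 1" using prime_gt_1_nat[OF p(1)] unfolding a_def by (intro one_less_power)
  have "b \<noteq> 1"
    using b(1) assms(2) \<open>multiplicity p n > 0\<close> p(1) by (metis mult.right_neutral primepow_prime_power)
  moreover have "b \<noteq> 0" using b(2) by (intro notI) simp
  ultimately have "b > 1" by simp
  have "coprime a b" unfolding a_def using p b(2) by (simp add: prime_imp_coprime)
  then obtain x where x: "[x = 0] (mod a)" "[x = 1] (mod b)"
    using binary_chinese_remainder_nat by blast
  have n: "n = a * b" using b(1) by (simp add: a_def)
  define t where "t = x mod n"
  have ta: "[t = 0] (mod a)" and tb: "[t = 1] (mod b)"
    using x by (simp_all add: t_def n cong_def mod_mod_cancel)
  have "t \<noteq> 0" using tb \<open>b > 1\<close> by (intro notI) (simp add: cong_def)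
  moreover have "t \<noteq> 1" using ta \<open>a > 1\<close> by (intro notI) (simp add: cong_def)
  ultimately have "1 < t" by simp
  moreover have "t < n" using assms by (simp add: t_def)
  moreover have "a dvd t" using ta by (simp add: cong_0_iff)
  moreover have "b dvd t - 1" by (rule cong_to_1_nat[OF tb])
  ultimately show ?thesis using n mult_dvd_mono by blast
qed

text \<open>Minimality leaves a single term in the expansion, the full block.\<close>

lemma root_sum_minimal_zero_sum:
  assumes "n > 0" "finite J" "i \<notin> J" "int n dvd k i + (\<Sum>c\<in>J. k c)"
    "\<And>C. C \<subset> J \<Longrightarrow> \<not> int n dvd k i + (\<Sum>c\<in>C. k c)"
  shows "root_sum n k (insert i J) = of_int ((-1) ^ card J * int (fact (card J) * n))"
proof -
  have "{C \<in> Pow J. int n dvd k i + (\<Sum>c\<in>C. k c)} = {J}" using assms(4,5) by auto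
  then show ?thesis unfolding root_sum_expansion[OF assms(1-3)] by simp
qed

text \<open>The exponents \<open>1\<close> (\<open>m\<close> times), \<open>2\<close> (\<open>t - 1 - m\<close> times), \<open>w\<close>, \<open>-1\<close> and \<open>0\<close> otherwise. The positive
  ones sum to \<open>n + 1\<close>, so the only proper zero-sum partition of the nonzero part splits off a pair
  \<open>{1, -1}\<close>.\<close>
locale vanishing_pattern =
  fixes n t m :: nat
  assumes t: "1 < t" "t < n" and nm: "n * m = t * (t - 1)"
begin

text \<open>The solution of \<open>m + 2 * (t - 1 - m) + w = n + 1\<close>, the prescribed total of
  the positive exponents.\<close>

definition w :: int where "w = int n + 3 + int m - 2 * int t"

definition expo :: "nat \<Rightarrow> int" where
  "expo i = (if i < m then 1 else if i < t - 1 then 2 else if i = t - 1 then w else if i = t then - 1 else 0)"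

text \<open>Since \<open>t < n\<close>, the equation \<open>nm\<close> forces
  \<open>m < t - 1\<close>; thus both exponents 1 and 2 really occur.\<close>

lemma m_bounds: "m > 0" "m + 2 \<le> t"
proof -
  have "n * m > 0" unfolding nm using t by simp
  then show "m > 0" by simp
  have "n * m < n * (t - 1)" unfolding nm using t by simp
  then have "m < t - 1" by simp
  then show "m + 2 \<le> t" by linarith
qed

text \<open>The reason is \<open>n * (w - 2) = (n - t) * (n - t + 1)\<close>. Consequently
  \<open>w\<close> is positive and not a further exponent 1.\<close>

lemma w_ge: "w \<ge> 2"
proof -
  have "int n * (w - 2) = int (n * m) + int n * (int n + 1 - 2 * int t)"
    by (simp add: w_def algebra_simps)
  also have "\<dots> = (int n - int t) * (int n - int t) + (int n - int t)"
    unfolding nm using t by (simp add: of_nat_diff algebra_simps)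
  also have "\<dots> \<ge> 0" using t by (intro add_nonneg_nonneg mult_nonneg_nonneg) auto
  finally have "w - 2 \<ge> 0" using t by (simp add: zero_le_mult_iff)
  then show ?thesis by simp
qed

lemma expo_pos: "i < t \<Longrightarrow> expo i \<ge> 1"
  using w_ge by (auto simp: expo_def)

lemma expo_eq_1_iff: "i < t \<Longrightarrow> expo i = 1 \<longleftrightarrow> i < m"
  using w_ge by (auto simp: expo_def)

lemma expo_t [simp]: "expo t = - 1"
  using t m_bounds by (auto simp: expo_def)

lemma sum_expo: "(\<Sum>i<t. expo i) = int n + 1"
proof -
  have "{..<t} = insert (t - 1) {..<t - 1}" using t by auto
  then have "(\<Sum>i<t. expo i) = w + (\<Sum>i<t - 1. expo i)"
    using m_bounds by (simp add: expo_def)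
  also have "(\<Sum>i<t - 1. expo i) = (\<Sum>i<t - 1. 2 - (if i < m then 1 else 0))"
    by (intro sum.cong) (auto simp: expo_def)
  also have "\<dots> = 2 * int (t - 1) - int (card ({..<t - 1} \<inter> {i. i < m}))"
    by (simp add: sum_subtractf sum.If_cases)
  also have "{..<t - 1} \<inter> {i. i < m} = {..<m}" using m_bounds by auto
  finally show ?thesis using t by (simp add: w_def of_nat_diff)
qed

lemma sum_expo_ge_card: "C \<subseteq> {..<t} \<Longrightarrow> (\<Sum>i\<in>C. expo i) \<ge> int (card C)"
  using sum_mono[of C "\<lambda>_. 1" expo] expo_pos by auto

lemma sum_expo_mono_strict:
  assumes "C \<subset> D" "D \<subseteq> {..<t}"
  shows "(\<Sum>i\<in>C. expo i) < (\<Sum>i\<in>D. expo i)"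
proof -
  have fin: "finite D" using assms finite_subset by auto
  have "(\<Sum>i\<in>D. expo i) = (\<Sum>i\<in>D - C. expo i) + (\<Sum>i\<in>C. expo i)"
    using assms fin by (intro sum.subset_diff) auto
  moreover have "card (D - C) > 0" using assms fin by (auto simp: card_gt_0_iff)
  moreover have "(\<Sum>i\<in>D - C. expo i) \<ge> int (card (D - C))"
    using assms by (intro sum_expo_ge_card) auto
  ultimately show ?thesis by linarith
qed

text \<open>Without one exponent 1 the positive exponents total exactly \<open>n\<close>. Nonempty
  proper subsets then have sums strictly between 0 and \<open>n\<close>, so only the full block
  counts.\<close>

lemma root_sum_remove_unit:
  assumes "j < m"
  shows "root_sum n expo ({..<t} - {j}) = of_int ((-1) ^ (t - 2) * int (fact (t - 2) * n))"
proof -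
  let ?T = "{..<t} - {j}"
  have j: "j < t" using assms m_bounds by simp
  have cT: "card ?T = t - 1" using j by simp
  then have "card ?T > 0" using t by simp
  then have "?T \<noteq> {}" using card_gt_0_iff by blast
  then obtain i where i: "i \<in> ?T" by blast
  define J where "J = ?T - {i}"
  have iJ: "?T = insert i J" "i \<notin> J" using i unfolding J_def by blast+
  have fJ: "finite J" by (simp add: J_def)
  have cJ: "card J = t - 2" using cT i by (simp add: J_def card_Diff_singleton)
  have total: "(\<Sum>c\<in>?T. expo c) = int n"
    using sum_expo j expo_eq_1_iff[OF j] assms by (simp add: sum_diff1)
  have "root_sum n expo (insert i J) = of_int ((-1) ^ card J * int (fact (card J) * n))"
  proof (rule root_sum_minimal_zero_sum[OF _ fJ iJ(2)])
    show "n > 0" using t by simp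
    have "expo i + (\<Sum>c\<in>J. expo c) = int n" using total iJ fJ by simp
    then show "int n dvd expo i + (\<Sum>c\<in>J. expo c)" by simp
    fix C assume C: "C \<subset> J"
    have fC: "finite C" "i \<notin> C" using C fJ finite_subset iJ by auto
    have "insert i C \<subset> ?T" unfolding iJ(1) using C iJ(2) fC(2) by (auto simp: psubset_eq insert_ident)
    then have "(\<Sum>c\<in>insert i C. expo c) < int n" using sum_expo_mono_strict[of "insert i C" ?T] total by auto
    moreover have "{} \<subset> insert i C" "insert i C \<subseteq> {..<t}" using \<open>insert i C \<subset> ?T\<close> by blast+
    then have "(\<Sum>c\<in>{}. expo c) < (\<Sum>c\<in>insert i C. expo c)" by (rule sum_expo_mono_strict)
    ultimately have "0 < expo i + (\<Sum>c\<in>C. expo c)" "expo i + (\<Sum>c\<in>C. expo c) < int n"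
      using fC by simp_all
    then show "\<not> int n dvd expo i + (\<Sum>c\<in>C. expo c)" by (simp add: zdvd_not_zless)
  qed
  then show ?thesis unfolding iJ(1) cJ .
qed

text \<open>Beside the exponent \<open>-1\<close>, the sum over \<open>C\<close> must be 1 modulo
  \<open>n\<close>. It lies between 0 and \<open>n + 1\<close>, so it is 1, from a single exponent
  1, or \<open>n + 1\<close>, from all of them.\<close>

lemma zero_sum_blocks:
  "{C \<in> Pow {..<t}. int n dvd expo t + (\<Sum>c\<in>C. expo c)} = insert {..<t} ((\<lambda>j. {j}) ` {..<m})"
proof (intro equalityI subsetI)
  fix C assume "C \<in> {C \<in> Pow {..<t}. int n dvd expo t + (\<Sum>c\<in>C. expo c)}"
  then have C: "C \<subseteq> {..<t}" "int n dvd (\<Sum>c\<in>C. expo c) - 1" by auto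
  have fC: "finite C" using C finite_subset by auto
  have ge: "(\<Sum>c\<in>C. expo c) \<ge> int (card C)" using C by (intro sum_expo_ge_card)
  show "C \<in> insert {..<t} ((\<lambda>j. {j}) ` {..<m})"
  proof (cases "C = {..<t}")
    case False
    then have "(\<Sum>c\<in>C. expo c) < int n + 1"
      using sum_expo_mono_strict[of C "{..<t}"] C sum_expo by auto
    then have "\<bar>(\<Sum>c\<in>C. expo c) - 1\<bar> < int n" using ge t by linarith
    then have one: "(\<Sum>c\<in>C. expo c) = 1"
      using C(2) dvd_imp_le_int[of "(\<Sum>c\<in>C. expo c) - 1" "int n"] by fastforce
    then have "C \<noteq> {}" by auto
    then have "card C = 1" using one ge fC card_gt_0_iff[of C] by linarith
    then obtain j where j: "C = {j}" by (auto simp: card_1_singleton_iff)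
    then have "j < m" using one C expo_eq_1_iff[of j] by simp
    then show ?thesis using j by simp
  qed simp
next
  fix C assume C: "C \<in> insert {..<t} ((\<lambda>j. {j}) ` {..<m})"
  then consider "C = {..<t}" | j where "j < m" "C = {j}" by auto
  then show "C \<in> {C \<in> Pow {..<t}. int n dvd expo t + (\<Sum>c\<in>C. expo c)}"
  proof cases
    case 1
    then show ?thesis by (simp add: sum_expo)
  next
    case 2
    then show ?thesis using m_bounds expo_eq_1_iff[of j] by auto
  qed
qed

lemma root_sum_nonzero_part: "root_sum n expo {..<Suc t} = 0"
proof -
  define T where "T C = of_int ((-1) ^ card C * int (fact (card C) * n)) * root_sum n expo ({..<t} - C)" for C
  have n: "n > 0" using t by simp
  obtain r where r: "t = Suc (Suc r)" using that[of "t - 2"] t by simp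
  have "{..<t} \<noteq> {j}" for j :: nat
  proof
    assume "{..<t} = {j}"
    then have "card {..<t} = 1" by simp
    then show False using t by simp
  qed
  then have notin: "{..<t} \<notin> (\<lambda>j. {j}) ` {..<m}" by auto
  have "{..<Suc t} = insert t {..<t}" by auto
  then have "root_sum n expo {..<Suc t} = (\<Sum>C\<in>insert {..<t} ((\<lambda>j. {j}) ` {..<m}). T C)"
    using root_sum_expansion[OF n, of "{..<t}" t expo] unfolding zero_sum_blocks T_def by simp
  also have "\<dots> = T {..<t} + (\<Sum>j<m. T {j})"
    using notin by (subst sum.insert) (auto simp: sum.reindex)
  also have "(\<Sum>j<m. T {j}) = (\<Sum>j<m. - of_nat n * of_int ((-1) ^ (t - 2) * int (fact (t - 2) * n)))"
    by (intro sum.cong refl) (simp add: T_def root_sum_remove_unit)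
  \<comment> \<open>With \<open>r = t - 2\<close> and the common factor pulled out, the full block
    gives \<open>t * (t - 1)\<close> because \<open>t! = t * (t - 1) * r!\<close>, and the
    \<open>m\<close> pairs give \<open>- n * m\<close>.\<close>
  also have "T {..<t} + \<dots> = of_int ((-1) ^ r * int (fact r) * int n * (int (t * (t - 1)) - int (n * m)))"
    by (simp add: T_def r algebra_simps)
  also have "\<dots> = 0" by (simp add: nm)
  finally show ?thesis .
qed

text \<open>Positions beyond \<open>t\<close> have exponent 0 and are added one at a time, which
  preserves vanishing.\<close>

lemma root_sum_vanishes: "root_sum n expo {..<n} = 0"
proof -
  have "root_sum n expo {..<i} = 0" if "Suc t \<le> i" for i
    using that
  proof (induction i rule: dec_induct)
    case base
    show ?case by (rule root_sum_nonzero_part)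
  next
    case (step i)
    have "expo i = 0" using step(1) m_bounds by (auto simp: expo_def)
    moreover have "{..<Suc i} = insert i {..<i}" by auto
    ultimately show ?case using step.IH root_sum_eq_0_insert[of "{..<i}" i expo] by simp
  qed
  then show ?thesis using t by simp
qed

lemma expo_ge: "expo i \<ge> - 1"
  using w_ge by (simp add: expo_def)

text \<open>Needed for \<open>expo i + 1\<close> to be a mode index. Strictness for \<open>w\<close>
  comes from \<open>t >= 3\<close>, a consequence of \<open>m_bounds\<close>.\<close>

lemma expo_less: "expo i < int n - 1"
  using t m_bounds by (auto simp: expo_def w_def)

lemma expo_eq_neg1_iff: "expo i = - 1 \<longleftrightarrow> i = t"
  using w_ge m_bounds by (auto simp: expo_def)

lemma sum_expo_all: "(\<Sum>i<n. expo i) = int n"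
proof -
  have "(\<Sum>i<n. expo i) = (\<Sum>i<Suc t. expo i)"
    using t m_bounds by (intro sum.mono_neutral_right) (auto simp: expo_def)
  then show ?thesis using sum_expo by simp
qed

theorem vanishing_fock_amp:
  "\<exists>s. length s = n \<and> sum_list s = n \<and> s ! 0 = 1 \<and> [(\<Sum>i<n. i * s ! i) = 0] (mod n)
    \<and> fock_amp n (fourier n) s = 0"
proof -
  \<comment> \<open>The shift by 1 turns exponents into modes: the single \<open>-1\<close> becomes
    mode 0, giving \<open>s ! 0 = 1\<close>, and the total becomes \<open>n + n\<close>.\<close>
  define k where "k j = nat (expo j + 1)" for j
  define s where "s = map (\<lambda>i. card {j\<in>{..<n}. k j = i}) [0..<n]"
  have n: "n > 0" using t by simp
  have int_k: "int (k j) = expo j + 1" for j using expo_ge[of j] by (simp add: k_def)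
  have k_lt: "k j < n" for j using int_k[of j] expo_less[of j] by linarith
  then have k: "k \<in> {..<n} \<rightarrow> {..<n}" by simp
  have s: "s ! i = card {j\<in>{..<n}. k j = i}" if "i < n" for i using that by (simp add: s_def)
  have "sum_list s = (\<Sum>i<n. 1 * card {j\<in>{..<n}. k j = i})"
    by (simp add: s_def interv_sum_list_conv_sum_set_nat atLeast0LessThan)
  also have "\<dots> = n" unfolding sum_card_fibres[OF k] by simp
  finally have "sum_list s = n" .
  moreover have "s ! 0 = 1"
  proof -
    have "k j = 0 \<longleftrightarrow> j = t" for j using int_k[of j] expo_eq_neg1_iff[of j] by linarith
    then have "{j\<in>{..<n}. k j = 0} = {t}" using t by auto
    then show ?thesis using s[OF n] by simp
  qed
  moreover have "[(\<Sum>i<n. i * s ! i) = 0] (mod n)"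
  proof -
    have "(\<Sum>i<n. i * s ! i) = (\<Sum>j<n. k j)" using s sum_card_fibres[OF k, of "\<lambda>i. i"] by simp
    moreover have "int (\<Sum>j<n. k j) = int (2 * n)"
      by (simp add: int_k sum.distrib sum_expo_all)
    then have "(\<Sum>j<n. k j) = 2 * n" by (simp only: of_nat_eq_iff)
    ultimately show ?thesis by (simp add: cong_0_iff)
  qed
  moreover have "fock_amp n (fourier n) s = 0"
    using fock_amp_fourier_eq_0_iff[of n k s 1] n k_lt s root_sum_vanishes by (simp add: int_k)
  ultimately show ?thesis by (intro exI[of _ s]) (simp add: s_def)
qed

end

section \<open>The zero transmission law and its failure\<close>

theorem fock_amp_fourier_prime_power:
  assumes n: "primepow n" and s: "length s = n" "sum_list s = n"
  shows "fock_amp n (fourier n) s \<noteq> 0 \<longleftrightarrow> [(\<Sum>i<n. i * s ! i) = 0] (mod n)"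
proof -
  obtain p l where p: "prime p" "n = p ^ l" using n by (auto simp: primepow_def)
  have n0: "n > 0" using n primepow_gt_0_nat by blast
  obtain k where k: "\<And>j. j < n \<Longrightarrow> k j < n" "\<And>i. i < n \<Longrightarrow> s ! i = card {j\<in>{..<n}. k j = i}"
    "(\<Sum>j<n. k j) = (\<Sum>i<n. i * s ! i)"
    using exists_enumeration[OF s] by blast
  have "fock_amp n (fourier n) s \<noteq> 0 \<longleftrightarrow> root_sum n (\<lambda>i. int (k i)) {..<n} \<noteq> 0"
    using fock_amp_fourier_eq_0_iff[of n k s 0] n0 k by simp
  also have "\<dots> \<longleftrightarrow> int n dvd (\<Sum>i<n. int (k i))"
    using root_sum_nonzero_imp_dvd[OF n0, of "{..<n}"]
      root_sum_prime_power_nonzero[OF p(1), of "{..<n}" l] p(2) by auto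
  also have "\<dots> \<longleftrightarrow> n dvd (\<Sum>i<n. k i)" by (simp flip: of_nat_sum)
  finally show ?thesis using k(3) by (simp add: cong_0_iff)
qed

theorem theorem5:
  fixes n :: nat
  assumes "n \<ge> 2"
  shows "(primepow n \<longrightarrow>
            (\<forall>s. length s = n \<and> sum_list s = n \<longrightarrow>
               (fock_amp n (fourier n) s \<noteq> 0 \<longleftrightarrow> [(\<Sum>i<n. i * s ! i) = 0] (mod n))) \<and>
            (\<forall>s. ideal_pattern n (fourier n) s \<longleftrightarrow>
               length s = n \<and> sum_list s = n \<and> s ! 0 = 1 \<and> [(\<Sum>i<n. i * s ! i) = 0] (mod n)))
       \<and> (\<not> primepow n \<longrightarrow>
            (\<exists>s. length s = n \<and> sum_list s = n \<and> s ! 0 = 1 \<and> [(\<Sum>i<n. i * s ! i) = 0] (mod n)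
                 \<and> \<not> ideal_pattern n (fourier n) s \<and> fock_amp n (fourier n) s = 0))"
proof (intro conjI impI)
  assume "primepow n"
  note amp = fock_amp_fourier_prime_power[OF this]
  show "\<forall>s. length s = n \<and> sum_list s = n \<longrightarrow>
      (fock_amp n (fourier n) s \<noteq> 0 \<longleftrightarrow> [(\<Sum>i<n. i * s ! i) = 0] (mod n))"
    using amp by blast
  show "\<forall>s. ideal_pattern n (fourier n) s \<longleftrightarrow>
      length s = n \<and> sum_list s = n \<and> s ! 0 = 1 \<and> [(\<Sum>i<n. i * s ! i) = 0] (mod n)"
    unfolding ideal_pattern_def using amp by blast
next
  assume "\<not> primepow n"
  then obtain t where t: "1 < t" "t < n" "n dvd t * (t - 1)"
    using exists_nontrivial_idempotent_mod assms by blast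
  then obtain m where "n * m = t * (t - 1)" by (metis dvdE)
  then interpret vanishing_pattern n t m using t by unfold_locales
  obtain s where "length s = n" "sum_list s = n" "s ! 0 = 1" "[(\<Sum>i<n. i * s ! i) = 0] (mod n)"
    "fock_amp n (fourier n) s = 0" using vanishing_fock_amp by blast
  then show "\<exists>s. length s = n \<and> sum_list s = n \<and> s ! 0 = 1 \<and> [(\<Sum>i<n. i * s ! i) = 0] (mod n)
      \<and> \<not> ideal_pattern n (fourier n) s \<and> fock_amp n (fourier n) s = 0"
    unfolding ideal_pattern_def by blast
qed

end
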